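(* Let $r\geq s\geq 3$ be integers. Let $G$ be an $r$-partite graph (not necessarily balanced) with vertex partition into parts $V_1,\dots,V_r$ that admits a fractional $K_s$-decomposition. Then $$d(v,V_k)\leq \frac{d(v)}{s-1}$$ for all $v\in V(G)$ and $1\leq k\leq r$. Furthermore, if $r=s+1$, then $$|E(V_i,V_j)|=\frac{d_i+d_j}{s-1}-\frac{|E(G)|}{\binom{s}{2}}$$ for all $1\leq i<j\leq s+1$, where $d_\ell=\sum_{k=1,\,k\neq\ell}^{s+1}|E(V_\ell,V_k)|$ for $1\leq\ell\leq s+1$.
   Context: All graphs are finite, undirected and simple. $V(G)$ and $E(G)$ are the vertex and edge sets of $G$; $d(v)$ is the degree of $v$; $d(v,U)$ is the number of neighbours of $v$ in $U\subseteq V(G)$; for disjoint $U_1,U_2\subseteq V(G)$, $E(U_1,U_2)$ is the set of edges of $G$ with one endpoint in $U_1$ and the other in $U_2$. An $r$-partite graph with parts $V_1,\dots,V_r$ is a graph whose vertex set is partitioned into $V_1,\dots,V_r$ with no edge inside any part. A copy of $K_s$ in $G$ is a subgraph of $G$ isomorphic to the complete graph on $s$ vertices. A fractional $K_s$-decomposition of $G$ is a weight function $w$ from the set of copies of $K_s$ in $G$ to $[0,1]$ such that for each edge $e\in E(G)$ the total weight of the copies of $K_s$ containing $e$ equals $1$. *)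

theory Defs
  imports Complex_Main "HOL-Library.Disjoint_Sets"
begin

record 'a ugraph =
  verts :: "'a set"
  edges :: "'a set set"

definition simple_graph :: "'a ugraph \<Rightarrow> bool" where
  "simple_graph G \<longleftrightarrow> finite (verts G) \<and> (\<forall>e\<in>edges G. e \<subseteq> verts G \<and> card e = 2)"

definition neighbours :: "'a ugraph \<Rightarrow> 'a \<Rightarrow> 'a set" where
  "neighbours G v = {u \<in> verts G. {u, v} \<in> edges G}"

definition degree :: "'a ugraph \<Rightarrow> 'a \<Rightarrow> nat" where
  "degree G v = card (neighbours G v)"

definition degree_into :: "'a ugraph \<Rightarrow> 'a \<Rightarrow> 'a set \<Rightarrow> nat" where
  "degree_into G v U = card (neighbours G v \<inter> U)"

definition edges_between :: "'a ugraph \<Rightarrow> 'a set \<Rightarrow> 'a set \<Rightarrow> 'a set set" where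
  "edges_between G U1 U2 = {e \<in> edges G. \<exists>u\<in>U1. \<exists>v\<in>U2. e = {u, v}}"

text \<open>The parts are \<open>V 1, \<dots>, V r\<close>; values of \<open>V\<close> outside \<open>{1..r}\<close> are irrelevant.
  Parts may be empty.\<close>

definition multipartite :: "'a ugraph \<Rightarrow> nat \<Rightarrow> (nat \<Rightarrow> 'a set) \<Rightarrow> bool" where
  "multipartite G r V \<longleftrightarrow>
     (\<Union>k\<in>{1..r}. V k) = verts G \<and> disjoint_family_on V {1..r} \<and>
     (\<forall>k\<in>{1..r}. \<forall>e\<in>edges G. \<not> e \<subseteq> V k)"

definition subgraph :: "'a ugraph \<Rightarrow> 'a ugraph \<Rightarrow> bool" where
  "subgraph H G \<longleftrightarrow> simple_graph H \<and> verts H \<subseteq> verts G \<and> edges H \<subseteq> edges G"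

definition isomorphic :: "'a ugraph \<Rightarrow> 'b ugraph \<Rightarrow> bool" where
  "isomorphic G H \<longleftrightarrow>
     (\<exists>f. bij_betw f (verts G) (verts H) \<and>
          (\<forall>u\<in>verts G. \<forall>v\<in>verts G. {u, v} \<in> edges G \<longleftrightarrow> {f u, f v} \<in> edges H))"

definition complete_graph :: "nat \<Rightarrow> nat ugraph" where
  "complete_graph s = \<lparr>verts = {..<s}, edges = {e. e \<subseteq> {..<s} \<and> card e = 2}\<rparr>"

definition clique_copies :: "'a ugraph \<Rightarrow> nat \<Rightarrow> 'a ugraph set" where
  "clique_copies G s = {H. subgraph H G \<and> isomorphic H (complete_graph s)}"

text \<open>Only the values of \<open>w\<close> on \<open>clique_copies G s\<close> matter. That set is finite
  whenever \<open>G\<close> is a simple graph, so the sum is a genuine finite sum.\<close>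

definition fractional_clique_decomposition ::
    "'a ugraph \<Rightarrow> nat \<Rightarrow> ('a ugraph \<Rightarrow> real) \<Rightarrow> bool" where
  "fractional_clique_decomposition G s w \<longleftrightarrow>
     (\<forall>H\<in>clique_copies G s. 0 \<le> w H \<and> w H \<le> 1) \<and>
     (\<forall>e\<in>edges G. (\<Sum>H\<in>{H \<in> clique_copies G s. e \<in> edges H}. w H) = 1)"

end

theory Submission
  imports Defs
begin

text \<open>
  Summing the defining equation of a fractional \<open>K\<^sub>s\<close>-decomposition \<open>w\<close> over the edges of any
  \<open>F \<subseteq> E(G)\<close> and exchanging the sums expresses \<open>|F|\<close> as the sum over the copies \<open>H\<close> of
  \<open>w(H) \<cdot> |F \<inter> E(H)|\<close> (lemma \<open>card_eq_weighted_sum\<close>).  So a linear relation between sizes of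
  edge sets holds in \<open>G\<close> as soon as it holds inside each single copy of \<open>K\<^sub>s\<close>, and a linear
  inequality does too because \<open>w \<ge> 0\<close>.

  Inside a copy \<open>H\<close> everything is determined by the vertex set: between disjoint sets \<open>U\<^sub>1\<close> and
  \<open>U\<^sub>2\<close> it has \<open>|H \<inter> U\<^sub>1| \<cdot> |H \<inter> U\<^sub>2|\<close> edges (\<open>card_edges_between_clique_copy\<close>).  As a part is independent in \<open>G\<close> and \<open>H\<close> is complete,
  \<open>H\<close> meets each part in at most one vertex.

  For the degree bound, a copy through \<open>v\<close> sends at most one edge from \<open>v\<close> to \<open>V\<^sub>k\<close> and exactly
  \<open>s - 1\<close> edges from \<open>v\<close> altogether.  For \<open>r = s + 1\<close>, write \<open>c\<^sub>k \<in> {0, 1}\<close> for \<open>|H \<inter> V\<^sub>k|\<close>.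
  As \<open>\<Sum>\<^sub>k c\<^sub>k = s\<close>, the copy misses exactly one part, hence \<open>c\<^sub>i c\<^sub>j = c\<^sub>i + c\<^sub>j - 1\<close>.  The copy contributes
  \<open>c\<^sub>i (s - 1)\<close> to \<open>d\<^sub>i\<close> and \<open>s choose 2\<close> to \<open>|E(G)|\<close>, so this is precisely the claimed formula for
  \<open>|E(V\<^sub>i, V\<^sub>j)|\<close> at \<open>H\<close>.
\<close>

section \<open>Copies of complete graphs\<close>

lemma finite_edges:
  assumes "simple_graph G"
  shows "finite (edges G)"
proof (rule finite_subset)
  show "edges G \<subseteq> Pow (verts G)" "finite (Pow (verts G))"
    using assms by (auto simp: simple_graph_def)
qed

lemma clique_copy_subset:
  assumes "H \<in> clique_copies G s"
  shows "verts H \<subseteq> verts G" "edges H \<subseteq> edges G"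
  using assms by (auto simp: clique_copies_def subgraph_def)

lemma finite_verts_clique_copy:
  assumes "simple_graph G" "H \<in> clique_copies G s"
  shows "finite (verts H)"
  using finite_subset[OF clique_copy_subset(1)[OF assms(2)]] assms(1)
  by (simp add: simple_graph_def)

lemma card_verts_clique_copy:
  assumes "H \<in> clique_copies G s"
  shows "card (verts H) = s"
proof -
  obtain f where "bij_betw f (verts H) {..<s}"
    using assms by (auto simp: clique_copies_def isomorphic_def complete_graph_def)
  then show ?thesis using bij_betw_same_card by fastforce
qed

lemma edges_clique_copy:
  assumes "H \<in> clique_copies G s"
  shows "edges H = {e. e \<subseteq> verts H \<and> card e = 2}"
proof
  show "edges H \<subseteq> {e. e \<subseteq> verts H \<and> card e = 2}"
    using assms by (auto simp: clique_copies_def subgraph_def simple_graph_def)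
  obtain f where f: "bij_betw f (verts H) {..<s}"
    and iso: "\<And>u v. u \<in> verts H \<Longrightarrow> v \<in> verts H \<Longrightarrow>
      {u, v} \<in> edges H \<longleftrightarrow> {f u, f v} \<subseteq> {..<s} \<and> card {f u, f v} = 2"
    using assms by (auto simp: clique_copies_def isomorphic_def complete_graph_def)
  show "{e. e \<subseteq> verts H \<and> card e = 2} \<subseteq> edges H"
  proof
    fix e assume "e \<in> {e. e \<subseteq> verts H \<and> card e = 2}"
    then obtain u v where e: "e = {u, v}" "u \<noteq> v" "u \<in> verts H" "v \<in> verts H"
      by (auto simp: card_2_iff)
    then have "f u \<noteq> f v" "f u \<in> {..<s}" "f v \<in> {..<s}"
      using f by (auto simp: bij_betw_def inj_on_def)
    with iso e show "e \<in> edges H" by simp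
  qed
qed

lemma finite_clique_copies:
  assumes "simple_graph G"
  shows "finite (clique_copies G s)"
proof (rule finite_subset)
  let ?K = "\<lambda>A. \<lparr>verts = A, edges = {e. e \<subseteq> A \<and> card e = 2}\<rparr>"
  show "clique_copies G s \<subseteq> ?K ` Pow (verts G)"
  proof
    fix H assume H: "H \<in> clique_copies G s"
    then have "H = ?K (verts H)" using edges_clique_copy[OF H] by simp
    with clique_copy_subset(1)[OF H] show "H \<in> ?K ` Pow (verts G)" by blast
  qed
  show "finite (?K ` Pow (verts G))" using assms by (simp add: simple_graph_def)
qed

section \<open>Edge sets as weighted sums over copies\<close>

text \<open>Double counting of the pairs of an edge in \<open>F\<close> and a copy through it.\<close>

lemma card_eq_weighted_sum:
  assumes G: "simple_graph G" and w: "fractional_clique_decomposition G s w"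
    and F: "F \<subseteq> edges G"
  shows "real (card F) = (\<Sum>H\<in>clique_copies G s. w H * real (card (F \<inter> edges H)))"
proof -
  have fin: "finite F" "finite (clique_copies G s)"
    using finite_subset[OF F finite_edges[OF G]] finite_clique_copies[OF G] by auto
  have "real (card F) = (\<Sum>e\<in>F. \<Sum>H\<in>{H \<in> clique_copies G s. e \<in> edges H}. w H)"
    using w F by (simp add: fractional_clique_decomposition_def subset_iff)
  also have "\<dots> = (\<Sum>H\<in>clique_copies G s. \<Sum>e\<in>{e \<in> F. e \<in> edges H}. w H)"
    using fin by (rule sum.swap_restrict)
  also have "\<dots> = (\<Sum>H\<in>clique_copies G s. w H * real (card (F \<inter> edges H)))"
    by (simp add: Int_def mult.commute)
  finally show ?thesis .
qed

lemma card_edges_between_clique_copy: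
  assumes H: "H \<in> clique_copies G s" and disj: "U1 \<inter> U2 = {}"
  shows "card (edges_between G U1 U2 \<inter> edges H) = card (verts H \<inter> U1) * card (verts H \<inter> U2)"
proof -
  let ?P = "(verts H \<inter> U1) \<times> (verts H \<inter> U2)"
  let ?f = "\<lambda>(u, v). {u, v}"
  have "edges_between G U1 U2 \<inter> edges H = ?f ` ?P"
  proof
    show "edges_between G U1 U2 \<inter> edges H \<subseteq> ?f ` ?P"
      using edges_clique_copy[OF H] by (auto simp: edges_between_def)
    show "?f ` ?P \<subseteq> edges_between G U1 U2 \<inter> edges H"
    proof
      fix e assume "e \<in> ?f ` ?P"
      then obtain u v where e: "e = {u, v}" "u \<in> verts H" "v \<in> verts H" "u \<in> U1" "v \<in> U2"
        by auto
      then have "u \<noteq> v" using disj by auto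
      with e have "e \<in> edges H" using edges_clique_copy[OF H] by simp
      then show "e \<in> edges_between G U1 U2 \<inter> edges H"
        using e clique_copy_subset(2)[OF H] by (auto simp: edges_between_def)
    qed
  qed
  moreover have "inj_on ?f ?P"
    using disj by (auto simp: inj_on_def doubleton_eq_iff)
  ultimately show ?thesis by (simp add: card_image card_cartesian_product)
qed

text \<open>Degrees become sizes of edge sets.  The vertex \<open>v\<close> is removed from \<open>U\<close> to make the two sides
  of the edge set disjoint.\<close>

lemma degree_into_eq_card_edges_between:
  assumes "simple_graph G"
  shows "degree_into G v U = card (edges_between G {v} (U - {v}))"
proof -
  have "u \<noteq> v \<and> u \<in> verts G" if "{u, v} \<in> edges G" for u
    using assms that by (force simp: simple_graph_def)
  then have "edges_between G {v} (U - {v}) = (\<lambda>u. {u, v}) ` (neighbours G v \<inter> U)"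
    by (fastforce simp: edges_between_def neighbours_def insert_commute)
  moreover have "inj_on (\<lambda>u. {u, v}) (neighbours G v \<inter> U)"
    by (auto simp: inj_on_def doubleton_eq_iff)
  ultimately show ?thesis by (simp add: degree_into_def card_image)
qed

lemma degree_eq_degree_into_verts: "degree G v = degree_into G v (verts G)"
proof -
  have "neighbours G v \<inter> verts G = neighbours G v" by (auto simp: neighbours_def)
  then show ?thesis by (simp add: degree_def degree_into_def)
qed

section \<open>Copies in a multipartite graph\<close>

lemma clique_copy_meets_part_le_1:
  assumes H: "H \<in> clique_copies G s" and V: "multipartite G r V" and k: "k \<in> {1..r}"
  shows "card (verts H \<inter> V k) \<le> 1"
proof (rule ccontr)
  assume "\<not> ?thesis"
  then have "2 \<le> card (verts H \<inter> V k)" by simp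
  then obtain e where e: "e \<subseteq> verts H \<inter> V k" "card e = 2"
    by (rule obtain_subset_with_card_n)
  then have "e \<in> edges G"
    using edges_clique_copy[OF H] clique_copy_subset(2)[OF H] by auto
  with e V k show False by (auto simp: multipartite_def)
qed

lemma sum_card_clique_copy_parts:
  assumes G: "simple_graph G" and H: "H \<in> clique_copies G s" and V: "multipartite G r V"
  shows "(\<Sum>k\<in>{1..r}. card (verts H \<inter> V k)) = s"
proof -
  have fin: "finite (verts H)"
    using finite_verts_clique_copy[OF G H] .
  have "verts H = (\<Union>k\<in>{1..r}. verts H \<inter> V k)"
    using V clique_copy_subset(1)[OF H] unfolding multipartite_def by blast
  then have "s = card (\<Union>k\<in>{1..r}. verts H \<inter> V k)"
    using card_verts_clique_copy[OF H] by simp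
  also have "\<dots> = (\<Sum>k\<in>{1..r}. card (verts H \<inter> V k))"
    using V fin by (intro card_UN_disjoint) (auto simp: multipartite_def disjoint_family_on_def)
  finally show ?thesis by simp
qed

section \<open>The degree bound\<close>

lemma card_clique_copy_star:
  assumes G: "simple_graph G" and H: "H \<in> clique_copies G s"
  shows "card (edges_between G {v} (verts G - {v}) \<inter> edges H)
    = card (verts H \<inter> {v}) * (s - 1)"
proof (cases "v \<in> verts H")
  case True
  have fin: "finite (verts H)"
    using finite_verts_clique_copy[OF G H] .
  have "verts H \<inter> (verts G - {v}) = verts H - {v}"
    using clique_copy_subset(1)[OF H] by auto
  then show ?thesis
    using True fin card_verts_clique_copy[OF H] card_edges_between_clique_copy[OF H]
    by (simp add: card_Diff_singleton)
next
  case False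
  then show ?thesis using card_edges_between_clique_copy[OF H] by simp
qed

lemma degree_into_part_le:
  assumes s: "s \<ge> 2" and G: "simple_graph G" and V: "multipartite G r V"
    and w: "fractional_clique_decomposition G s w" and k: "k \<in> {1..r}"
  shows "real (degree_into G v (V k)) \<le> real (degree G v) / (real s - 1)"
proof -
  let ?A = "edges_between G {v} (V k - {v})" and ?B = "edges_between G {v} (verts G - {v})"
  have copy: "card (?A \<inter> edges H) * (s - 1) \<le> card (?B \<inter> edges H)"
    if H: "H \<in> clique_copies G s" for H
  proof -
    have "finite (verts H)"
      using finite_verts_clique_copy[OF G H] .
    then have "card (verts H \<inter> (V k - {v})) \<le> card (verts H \<inter> V k)"
      by (intro card_mono) auto
    also have "\<dots> \<le> 1" using clique_copy_meets_part_le_1[OF H V k] .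
    finally have "card (verts H \<inter> {v}) * card (verts H \<inter> (V k - {v})) \<le> card (verts H \<inter> {v})"
      using mult_le_mono2 by fastforce
    then show ?thesis
      unfolding card_clique_copy_star[OF G H]
      by (simp add: card_edges_between_clique_copy[OF H] mult_le_mono1)
  qed
  have "real (card ?A) * (real s - 1)
      = (\<Sum>H\<in>clique_copies G s. w H * real (card (?A \<inter> edges H) * (s - 1)))"
    using s by (subst card_eq_weighted_sum[OF G w])
      (auto simp: edges_between_def sum_distrib_right mult.assoc)
  also have "\<dots> \<le> (\<Sum>H\<in>clique_copies G s. w H * real (card (?B \<inter> edges H)))"
    using w by (intro sum_mono mult_left_mono of_nat_mono copy)
      (auto simp: fractional_clique_decomposition_def)
  also have "\<dots> = real (card ?B)"
    by (rule card_eq_weighted_sum[OF G w, symmetric]) (auto simp: edges_between_def)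
  finally show ?thesis
    using s by (simp add: degree_eq_degree_into_verts degree_into_eq_card_edges_between[OF G]
      pos_le_divide_eq)
qed

section \<open>Edges between parts when there are \<open>s + 1\<close> parts\<close>

lemma card_edges_clique_copy:
  assumes G: "simple_graph G" and H: "H \<in> clique_copies G s"
  shows "card (edges G \<inter> edges H) = s choose 2"
proof -
  have "finite (verts H)"
    using finite_verts_clique_copy[OF G H] .
  moreover have "edges G \<inter> edges H = {e. e \<subseteq> verts H \<and> card e = 2}"
    using clique_copy_subset(2)[OF H] edges_clique_copy[OF H] by auto
  ultimately show ?thesis
    by (simp only: n_subsets card_verts_clique_copy[OF H])
qed

text \<open>The edges of a copy at the part \<open>V i\<close>: either it misses the part, or it has one vertex there,
  all of whose \<open>s - 1\<close> edges lead to other parts.\<close>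

lemma sum_card_clique_copy_edges_at_part:
  assumes G: "simple_graph G" and H: "H \<in> clique_copies G s" and V: "multipartite G r V"
    and i: "i \<in> {1..r}"
  shows "(\<Sum>k\<in>{1..r} - {i}. real (card (edges_between G (V i) (V k) \<inter> edges H)))
    = real (card (verts H \<inter> V i)) * (real s - 1)"
proof -
  let ?c = "\<lambda>k. real (card (verts H \<inter> V k))"
  have "(\<Sum>k\<in>{1..r} - {i}. real (card (edges_between G (V i) (V k) \<inter> edges H)))
      = (\<Sum>k\<in>{1..r} - {i}. ?c i * ?c k)"
  proof (rule sum.cong[OF refl])
    fix k assume "k \<in> {1..r} - {i}"
    then have "V i \<inter> V k = {}"
      using V i by (auto simp: multipartite_def disjoint_family_on_def)
    then show "real (card (edges_between G (V i) (V k) \<inter> edges H)) = ?c i * ?c k"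
      by (simp add: card_edges_between_clique_copy[OF H])
  qed
  also have "\<dots> = ?c i * ((\<Sum>k\<in>{1..r}. ?c k) - ?c i)"
    using i by (simp add: sum_distrib_left[symmetric] sum_diff1)
  also have "(\<Sum>k\<in>{1..r}. ?c k) = real s"
    unfolding sum_card_clique_copy_parts[OF G H V, symmetric] by simp
  also have "?c i * (real s - ?c i) = ?c i * (real s - 1)"
    using clique_copy_meets_part_le_1[OF H V i] by (cases "card (verts H \<inter> V i)") auto
  finally show ?thesis .
qed

text \<open>With \<open>s + 1\<close> parts for \<open>s\<close> vertices, a copy cannot miss two different parts.\<close>

lemma clique_copy_meets_one_of_two_parts:
  assumes G: "simple_graph G" and H: "H \<in> clique_copies G s" and V: "multipartite G (s + 1) V"
    and i: "i \<in> {1..s + 1}" and j: "j \<in> {1..s + 1}" and ij: "i \<noteq> j"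
  shows "1 \<le> card (verts H \<inter> V i) + card (verts H \<inter> V j)"
proof -
  let ?c = "\<lambda>k. card (verts H \<inter> V k)"
  have "(\<Sum>k\<in>{1..s + 1} - {i, j}. ?c k) \<le> (\<Sum>k\<in>{1..s + 1} - {i, j}. 1)"
    by (intro sum_mono clique_copy_meets_part_le_1[OF H V]) auto
  also have "\<dots> = card ({1..s + 1} - {i, j})" by simp
  also have "\<dots> = s - 1" using i j ij by (subst card_Diff_subset) auto
  finally have "(\<Sum>k\<in>{1..s + 1} - {i, j}. ?c k) \<le> s - 1" .
  moreover have "(\<Sum>k\<in>{1..s + 1}. ?c k)
      = (\<Sum>k\<in>{1..s + 1} - {i, j}. ?c k) + (\<Sum>k\<in>{i, j}. ?c k)"
    using i j by (intro sum.subset_diff) auto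
  moreover have "1 \<le> s" using i j ij by auto
  ultimately show ?thesis
    using sum_card_clique_copy_parts[OF G H V] ij by simp
qed

lemma card_edges_between_parts:
  assumes s: "s \<ge> 2" and G: "simple_graph G" and V: "multipartite G (s + 1) V"
    and w: "fractional_clique_decomposition G s w"
    and i: "i \<in> {1..s + 1}" and j: "j \<in> {1..s + 1}" and ij: "i \<noteq> j"
  defines "d \<equiv> \<lambda>l. \<Sum>k\<in>{1..s + 1} - {l}. real (card (edges_between G (V l) (V k)))"
  shows "real (card (edges_between G (V i) (V j)))
    = (d i + d j) / (real s - 1) - real (card (edges G)) / real (s choose 2)"
proof -
  let ?C = "clique_copies G s"
  let ?c = "\<lambda>H k. real (card (verts H \<inter> V k))"
  note weighted = card_eq_weighted_sum[OF G w]
  have d: "d l / (real s - 1) = (\<Sum>H\<in>?C. w H * ?c H l)" if l: "l \<in> {1..s + 1}" for l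
  proof -
    have "d l = (\<Sum>k\<in>{1..s + 1} - {l}. \<Sum>H\<in>?C.
        w H * real (card (edges_between G (V l) (V k) \<inter> edges H)))"
      unfolding d_def by (intro sum.cong refl weighted) (auto simp: edges_between_def)
    also have "\<dots> = (\<Sum>H\<in>?C. w H *
        (\<Sum>k\<in>{1..s + 1} - {l}. real (card (edges_between G (V l) (V k) \<inter> edges H))))"
      by (subst sum.swap) (simp add: sum_distrib_left)
    also have "\<dots> = (\<Sum>H\<in>?C. w H * (?c H l * (real s - 1)))"
      by (intro sum.cong refl) (simp only: sum_card_clique_copy_edges_at_part[OF G _ V l])
    also have "\<dots> = (\<Sum>H\<in>?C. w H * ?c H l) * (real s - 1)"
      by (simp add: sum_distrib_right mult.assoc)
    finally show ?thesis using s by simp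
  qed
  have "real (card (edges G)) = (\<Sum>H\<in>?C. w H * real (s choose 2))"
    unfolding weighted[OF subset_refl]
    by (intro sum.cong refl) (simp only: card_edges_clique_copy[OF G])
  also have "\<dots> = (\<Sum>H\<in>?C. w H) * real (s choose 2)"
    by (simp add: sum_distrib_right)
  finally have total: "real (card (edges G)) / real (s choose 2) = (\<Sum>H\<in>?C. w H)"
    using s by simp
  have copy: "real (card (edges_between G (V i) (V j) \<inter> edges H)) = ?c H i + ?c H j - 1"
    if H: "H \<in> ?C" for H
  proof -
    have "V i \<inter> V j = {}"
      using V i j ij by (auto simp: multipartite_def disjoint_family_on_def)
    then have "real (card (edges_between G (V i) (V j) \<inter> edges H)) = ?c H i * ?c H j"
      by (simp add: card_edges_between_clique_copy[OF H])
    moreover have "card (verts H \<inter> V i) = 1 \<or> card (verts H \<inter> V j) = 1"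
      using clique_copy_meets_part_le_1[OF H V i] clique_copy_meets_part_le_1[OF H V j]
        clique_copy_meets_one_of_two_parts[OF G H V i j ij] by linarith
    ultimately show ?thesis by auto
  qed
  have "real (card (edges_between G (V i) (V j)))
      = (\<Sum>H\<in>?C. w H * real (card (edges_between G (V i) (V j) \<inter> edges H)))"
    by (rule weighted) (auto simp: edges_between_def)
  also have "\<dots> = (\<Sum>H\<in>?C. w H * (?c H i + ?c H j - 1))"
    by (intro sum.cong refl) (simp only: copy)
  also have "\<dots> = (\<Sum>H\<in>?C. w H * ?c H i) + (\<Sum>H\<in>?C. w H * ?c H j) - (\<Sum>H\<in>?C. w H)"
    by (simp add: sum.distrib sum_subtractf algebra_simps)
  finally show ?thesis
    using d[OF i] d[OF j] total by (simp add: add_divide_distrib)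
qed

theorem proposition1p1:
  fixes G :: "'a ugraph" and V :: "nat \<Rightarrow> 'a set" and r s :: nat
  assumes "r \<ge> s" and "s \<ge> 3"
    and "simple_graph G"
    and "multipartite G r V"
    and "\<exists>w. fractional_clique_decomposition G s w"
  shows "(\<forall>v\<in>verts G. \<forall>k\<in>{1..r}.
            real (degree_into G v (V k)) \<le> real (degree G v) / (real s - 1)) \<and>
         (r = s + 1 \<longrightarrow>
            (let d = (\<lambda>l. \<Sum>k\<in>{1..s + 1} - {l}. real (card (edges_between G (V l) (V k))))
             in \<forall>i j. 1 \<le> i \<and> i < j \<and> j \<le> s + 1 \<longrightarrow>
                  real (card (edges_between G (V i) (V j))) =
                    (d i + d j) / (real s - 1) - real (card (edges G)) / real (s choose 2)))"
proof -
  obtain w where w: "fractional_clique_decomposition G s w" using assms(5) by blast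
  have s: "s \<ge> 2" using assms(2) by simp
  show ?thesis
    unfolding Let_def
  proof (intro conjI ballI impI allI)
    fix v k assume "k \<in> {1..r}"
    then show "real (degree_into G v (V k)) \<le> real (degree G v) / (real s - 1)"
      by (rule degree_into_part_le[OF s assms(3,4) w])
  next
    fix i j assume r: "r = s + 1" and "1 \<le> i \<and> i < j \<and> j \<le> s + 1"
    then have "i \<in> {1..s + 1}" "j \<in> {1..s + 1}" "i \<noteq> j" by auto
    then show "real (card (edges_between G (V i) (V j))) =
        ((\<Sum>k\<in>{1..s + 1} - {i}. real (card (edges_between G (V i) (V k)))) +
         (\<Sum>k\<in>{1..s + 1} - {j}. real (card (edges_between G (V j) (V k))))) / (real s - 1) -
        real (card (edges G)) / real (s choose 2)"
      using assms(4) unfolding r by (intro card_edges_between_parts[OF s assms(3) _ w])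
  qed
qed

end
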